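(* Let $k$ be a positive integer and let $A_k$ be the $k$-element antichain. A poset $Q$ is weakly $A_k$-free if and only if $|Q|\le k-1$. Consequently, for positive integers $n,l,t$, if $l\ge 2$ and $n\ge k-2$, then \[ \operatorname{RT}(\mathcal{B};n,A_k,l,t)=\binom{k-1}{t}, \] with the convention $\binom{k-1}{t}=0$ when $t>k-1$. For $l=1$, the value of $\operatorname{RT}(\mathcal{B};n,A_k,l,t)$ is $0$.
   Context: $B_n$ is the power set of $[n]=\{1,\dots,n\}$ ordered by inclusion; a subset $Q\subseteq B_n$ (possibly empty) is regarded as a poset with the induced order. A $t$-chain in a poset is a set of exactly $t$ distinct pairwise comparable elements, and $\mathcal{C}_t(Q)$ is the set of all $t$-chains of $Q$. The width $w(Q)$ is the size of a largest antichain of $Q$ (with $w(\emptyset)=0$). $A_k$ is the poset with $k$ pairwise incomparable elements. An injection $f:P\to Q$ between posets is a weak embedding if $x\le y$ in $P$ implies $f(x)\le f(y)$ in $Q$. $Q$ is weakly $P$-free if there is no weak embedding of $P$ into $Q$. $\operatorname{RT}(\mathcal{B};n,P,l,t)$ is the maximum of $|\mathcal{C}_t(Q)|$ over all $Q\subseteq B_n$ such that $Q$ is weakly $P$-free and $w(Q)<l$. *)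

theory Defs
  imports Complex_Main
begin

(* A poset is a relation r with Partial_order r; its carrier is Field r. *)

definition weak_embedding :: "'p rel \<Rightarrow> 'q rel \<Rightarrow> ('p \<Rightarrow> 'q) \<Rightarrow> bool" where
  "weak_embedding P Q f \<longleftrightarrow>
     f ` Field P \<subseteq> Field Q \<and> inj_on f (Field P) \<and> (\<forall>x y. (x, y) \<in> P \<longrightarrow> (f x, f y) \<in> Q)"

definition weakly_free :: "'p rel \<Rightarrow> 'q rel \<Rightarrow> bool" where
  "weakly_free P Q \<longleftrightarrow> (\<nexists>f. weak_embedding P Q f)"

definition t_chains :: "nat \<Rightarrow> 'q rel \<Rightarrow> 'q set set" where
  "t_chains t Q = {C. C \<subseteq> Field Q \<and> finite C \<and> card C = t \<and>
     (\<forall>x\<in>C. \<forall>y\<in>C. (x, y) \<in> Q \<or> (y, x) \<in> Q)}"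

definition is_antichain :: "'q rel \<Rightarrow> 'q set \<Rightarrow> bool" where
  "is_antichain Q A \<longleftrightarrow> A \<subseteq> Field Q \<and> (\<forall>x\<in>A. \<forall>y\<in>A. x \<noteq> y \<longrightarrow> (x, y) \<notin> Q)"

(* Meaningful for finite posets only, since Max is unspecified on infinite sets. *)
definition width :: "'q rel \<Rightarrow> nat" where
  "width Q = Max {card A | A. is_antichain Q A}"

definition antichain_poset :: "nat \<Rightarrow> nat rel" where
  "antichain_poset k = Id_on {1..k}"

definition boolean_carrier :: "nat \<Rightarrow> nat set set" where
  "boolean_carrier n = Pow {1..n}"

definition induced :: "nat set set \<Rightarrow> nat set rel" where
  "induced Q = relation_of (\<subseteq>) Q"

(* Max is taken over a finite set. That set is nonempty whenever P is nonempty and l > 0,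
   because the empty family is then admissible. *)
definition RT_B :: "nat \<Rightarrow> 'p rel \<Rightarrow> nat \<Rightarrow> nat \<Rightarrow> nat" where
  "RT_B n P l t = Max {card (t_chains t (induced Q)) | Q.
     Q \<subseteq> boolean_carrier n \<and> weakly_free P (induced Q) \<and> width (induced Q) < l}"

end

theory Submission
  imports Defs
begin

text \<open>The only relations in the antichain \<open>A\<^sub>k\<close> are the reflexive ones, so a weak embedding of it
  into a poset is just an injection of a \<open>k\<close>-element set into the carrier. Being weakly
  \<open>A\<^sub>k\<close>-free is therefore the size condition \<open>|Q| < k\<close>
  (\<open>weakly_free_antichain_poset_iff\<close>).

  Under this condition the number of \<open>t\<close>-chains is at most the number of \<open>t\<close>-subsets of \<open>Q\<close>, hence
  at most \<open>(k - 1) choose t\<close> (\<open>card_t_chains_le\<close>), and equality holds when \<open>Q\<close> is a chain with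
  \<open>k - 1\<close> elements. Such a chain has width at most \<open>1\<close>, so it is admissible as soon as \<open>l \<ge> 2\<close>,
  and it exists in \<open>B\<^sub>n\<close> because the maximal chains of \<open>B\<^sub>n\<close> have \<open>n + 1 \<ge> k - 1\<close> elements.
  For \<open>l = 1\<close> only the empty family is admissible, since any element is an antichain by itself, and
  it has no \<open>t\<close>-chain for \<open>t \<ge> 1\<close>.\<close>

lemma Field_induced [simp]: "Field (induced Q) = Q"
  by (auto simp: induced_def relation_of_def Field_def)

lemma induced_iff [simp]: "(x, y) \<in> induced Q \<longleftrightarrow> x \<in> Q \<and> y \<in> Q \<and> x \<subseteq> y"
  by (auto simp: induced_def relation_of_def)

lemma Partial_order_induced: "Partial_order (induced Q)"
  unfolding partial_order_on_def preorder_on_def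
  by (auto simp: refl_on_def antisym_def trans_def)

lemma finite_subset_boolean_carrier:
  assumes "Q \<subseteq> boolean_carrier n"
  shows "finite Q"
  using assms finite_subset by (auto simp: boolean_carrier_def)

lemma Field_antichain_poset [simp]: "Field (antichain_poset k) = {1..k}"
  by (auto simp: antichain_poset_def Field_def)

text \<open>Reflexivity of \<open>Q\<close> makes monotonicity automatic.\<close>

lemma weak_embedding_antichain_poset_iff:
  assumes "Partial_order Q"
  shows "weak_embedding (antichain_poset k) Q f \<longleftrightarrow> f ` {1..k} \<subseteq> Field Q \<and> inj_on f {1..k}"
proof -
  have "(z, z) \<in> Q" if "z \<in> Field Q" for z
    using assms that by (auto simp: partial_order_on_def preorder_on_def refl_on_def)
  then show ?thesis
    unfolding weak_embedding_def Field_antichain_poset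
    by (auto simp: antichain_poset_def image_subset_iff)
qed

lemma weakly_free_antichain_poset_iff:
  assumes "Partial_order Q" and "k \<ge> 1"
  shows "weakly_free (antichain_poset k) Q \<longleftrightarrow> finite (Field Q) \<and> card (Field Q) \<le> k - 1"
proof
  assume free: "weakly_free (antichain_poset k) Q"
  show "finite (Field Q) \<and> card (Field Q) \<le> k - 1"
  proof (rule ccontr)
    assume "\<not> (finite (Field Q) \<and> card (Field Q) \<le> k - 1)"
    then have "infinite (Field Q) \<or> k \<le> card (Field Q)"
      by auto
    then obtain B where B: "B \<subseteq> Field Q" "finite B" "card B = k"
      by (metis infinite_arbitrarily_large obtain_subset_with_card_n)
    then obtain f where "bij_betw f {1..k} B"
      by (metis finite_same_card_bij finite_atLeastAtMost card_atLeastAtMost diff_Suc_1)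
    then have "weak_embedding (antichain_poset k) Q f"
      using B assms(1) by (simp add: weak_embedding_antichain_poset_iff bij_betw_def)
    then show False
      using free by (auto simp: weakly_free_def)
  qed
next
  assume small: "finite (Field Q) \<and> card (Field Q) \<le> k - 1"
  then have "card {1..k} \<le> card (Field Q)" if "weak_embedding (antichain_poset k) Q f" for f
    using that assms(1) by (intro card_inj_on_le[of f]) (auto simp: weak_embedding_antichain_poset_iff)
  then show "weakly_free (antichain_poset k) Q"
    using small \<open>k \<ge> 1\<close> by (fastforce simp: weakly_free_def)
qed

lemma finite_antichain_cards:
  assumes "finite (Field Q)"
  shows "finite {card A | A. is_antichain Q A}"
proof -
  have "{card A | A. is_antichain Q A} \<subseteq> card ` Pow (Field Q)"
    by (auto simp: is_antichain_def)
  then show ?thesis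
    using assms finite_subset by blast
qed

lemma width_ge:
  assumes "finite (Field Q)" and "is_antichain Q A"
  shows "card A \<le> width Q"
  unfolding width_def using assms by (intro Max_ge finite_antichain_cards) auto

lemma width_le:
  assumes "finite (Field Q)" and "\<And>A. is_antichain Q A \<Longrightarrow> card A \<le> m"
  shows "width Q \<le> m"
proof -
  have "is_antichain Q {}"
    by (simp add: is_antichain_def)
  then have "{card A | A. is_antichain Q A} \<noteq> {}"
    by blast
  then show ?thesis
    unfolding width_def using assms by (subst Max_le_iff) (auto simp: finite_antichain_cards)
qed

lemma width_chain_le:
  assumes "finite (Field Q)" and "\<And>x y. x \<in> Field Q \<Longrightarrow> y \<in> Field Q \<Longrightarrow> (x, y) \<in> Q \<or> (y, x) \<in> Q"
  shows "width Q \<le> 1"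
proof (rule width_le[OF assms(1)])
  fix A
  assume A: "is_antichain Q A"
  have "x = y" if "x \<in> A" "y \<in> A" for x y
  proof -
    have "(x, y) \<in> Q \<or> (y, x) \<in> Q"
      using A that by (intro assms(2)) (auto simp: is_antichain_def)
    then show ?thesis
      using A that by (auto simp: is_antichain_def)
  qed
  moreover have "finite A"
    using A assms(1) finite_subset by (auto simp: is_antichain_def)
  ultimately show "card A \<le> 1"
    by (auto simp: card_le_Suc0_iff_eq)
qed

lemma width_less_1_iff:
  assumes "finite (Field Q)"
  shows "width Q < 1 \<longleftrightarrow> Field Q = {}"
proof
  assume less: "width Q < 1"
  have "card {x} \<le> width Q" if "x \<in> Field Q" for x
    using that by (intro width_ge[OF assms]) (auto simp: is_antichain_def)
  then show "Field Q = {}"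
    using less by fastforce
next
  assume "Field Q = {}"
  then have "width Q \<le> 0"
    by (intro width_le[OF assms]) (auto simp: is_antichain_def)
  then show "width Q < 1"
    by simp
qed

lemma card_t_chains_le:
  assumes "finite (Field Q)" and "card (Field Q) \<le> m"
  shows "card (t_chains t Q) \<le> m choose t"
proof -
  have "card (t_chains t Q) \<le> card {C. C \<subseteq> Field Q \<and> card C = t}"
    using assms(1) by (intro card_mono) (auto simp: t_chains_def)
  also have "\<dots> = card (Field Q) choose t"
    using assms(1) by (rule n_subsets)
  also have "\<dots> \<le> m choose t"
    using assms(2) by (rule binomial_right_mono)
  finally show ?thesis .
qed

lemma card_t_chains_chain:
  assumes "finite (Field Q)" and "\<And>x y. x \<in> Field Q \<Longrightarrow> y \<in> Field Q \<Longrightarrow> (x, y) \<in> Q \<or> (y, x) \<in> Q"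
  shows "card (t_chains t Q) = card (Field Q) choose t"
proof -
  have "t_chains t Q = {C. C \<subseteq> Field Q \<and> card C = t}"
    using assms by (auto simp: t_chains_def subset_iff intro: rev_finite_subset)
  then show ?thesis
    using assms(1) by (simp add: n_subsets)
qed

text \<open>The initial segments \<open>{1..i}\<close> form a maximal chain of \<open>B\<^sub>n\<close>, of which any number of members
  up to \<open>n + 1\<close> can be kept.\<close>

lemma chain_in_boolean_carrier:
  assumes "m \<le> n + 1"
  obtains Q where "Q \<subseteq> boolean_carrier n" "finite Q" "card Q = m"
    "\<And>x y. x \<in> Q \<Longrightarrow> y \<in> Q \<Longrightarrow> x \<subseteq> y \<or> y \<subseteq> x"
proof
  let ?Q = "(\<lambda>i. {1..i}) ` {..<m}"
  show "?Q \<subseteq> boolean_carrier n"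
    using assms by (auto simp: boolean_carrier_def)
  show "finite ?Q"
    by simp
  have "inj_on (\<lambda>i::nat. {1..i}) {..<m}"
    by (rule inj_onI) (metis card_atLeastAtMost diff_Suc_1)
  then show "card ?Q = m"
    by (simp add: card_image)
  show "x \<subseteq> y \<or> y \<subseteq> x" if "x \<in> ?Q" "y \<in> ?Q" for x y
    using that by auto
qed

theorem mainTheorem9:
  fixes k :: nat
  assumes "k \<ge> 1"
  shows "(\<forall>Q :: 'a rel. Partial_order Q \<longrightarrow>
            (weakly_free (antichain_poset k) Q \<longleftrightarrow> finite (Field Q) \<and> card (Field Q) \<le> k - 1))
       \<and> (\<forall>n l t :: nat. n \<ge> 1 \<longrightarrow> l \<ge> 2 \<longrightarrow> t \<ge> 1 \<longrightarrow> int n \<ge> int k - 2 \<longrightarrow>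
            RT_B n (antichain_poset k) l t = (k - 1) choose t)
       \<and> (\<forall>n t :: nat. n \<ge> 1 \<longrightarrow> t \<ge> 1 \<longrightarrow> RT_B n (antichain_poset k) 1 t = 0)"
proof (intro conjI allI impI)
  fix Q :: "'a rel"
  assume "Partial_order Q"
  then show "weakly_free (antichain_poset k) Q \<longleftrightarrow> finite (Field Q) \<and> card (Field Q) \<le> k - 1"
    using assms by (rule weakly_free_antichain_poset_iff)
next
  have free_iff: "weakly_free (antichain_poset k) (induced Q) \<longleftrightarrow> finite Q \<and> card Q \<le> k - 1" for Q
    using weakly_free_antichain_poset_iff[OF Partial_order_induced assms] by simp
  {
    fix n l t :: nat
    assume l: "l \<ge> 2" and "int n \<ge> int k - 2"
    then have "k - 1 \<le> n + 1"
      by linarith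
    then obtain Q where Q: "Q \<subseteq> boolean_carrier n" "finite Q" "card Q = k - 1"
      and chain: "\<And>x y. x \<in> Q \<Longrightarrow> y \<in> Q \<Longrightarrow> x \<subseteq> y \<or> y \<subseteq> x"
      using chain_in_boolean_carrier by blast
    let ?S = "{card (t_chains t (induced Q)) | Q. Q \<subseteq> boolean_carrier n \<and>
      weakly_free (antichain_poset k) (induced Q) \<and> width (induced Q) < l}"
    have bound: "x \<le> (k - 1) choose t" if "x \<in> ?S" for x
      using that by (auto simp: free_iff intro!: card_t_chains_le)
    have "width (induced Q) \<le> 1"
      using Q chain by (intro width_chain_le) auto
    moreover have "card (t_chains t (induced Q)) = (k - 1) choose t"
      using Q chain card_t_chains_chain[of "induced Q" t] by auto
    ultimately have attained: "(k - 1) choose t \<in> ?S"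
      using Q l by (intro CollectI exI[of _ Q]) (simp add: free_iff)
    have "finite ?S"
      using bound by (intro finite_subset[of ?S "{..(k - 1) choose t}"]) auto
    then show "RT_B n (antichain_poset k) l t = (k - 1) choose t"
      unfolding RT_B_def using bound attained by (intro Max_eqI) auto
  }
  {
    fix n t :: nat
    assume t: "t \<ge> 1"
    have "Q \<subseteq> boolean_carrier n \<and> weakly_free (antichain_poset k) (induced Q) \<and>
        width (induced Q) < 1 \<longleftrightarrow> Q = {}" for Q
      using width_less_1_iff[of "induced Q"] finite_subset_boolean_carrier[of Q n]
      by (auto simp: free_iff)
    moreover have "t_chains t (induced {}) = {}"
      using t by (auto simp: t_chains_def)
    ultimately show "RT_B n (antichain_poset k) 1 t = 0"
      by (simp add: RT_B_def)
  }
qed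

end
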